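(* Consider a feasible sortition instance (i.e. $\mathcal P\ne\emptyset$) with a single feature $f$ with values $V_f=\{v_1,\dots,v_m\}$ and tight quotas $k_j:=\ell_{f,v_j}=u_{f,v_j}$ for all $j\in\{1,\dots,m\}$. Then MaxEntropy, i.e. drawing a panel from the uniform distribution over $\mathcal P$, is equivalent to stratified sampling: both procedures induce the same probability distribution over subsets of $N$.
   Context: Sortition instance with a single feature: pool members $N=\{1,\dots,n\}$, a feature $f:N\to V_f$, a panel size $k$, and integer quotas $0\le\ell_{f,v}\le u_{f,v}\le k$ for $v\in V_f$. A panel is a set $P\subseteq N$ with $|P|=k$ and $\ell_{f,v}\le|\{i\in P:f(i)=v\}|\le u_{f,v}$ for all $v\in V_f$; $\mathcal P$ is the set of panels. MaxEntropy draws a panel uniformly from $\mathcal P$. Stratified sampling: with strata $N_j=\{i\in N: f(i)=v_j\}$, draw independently, for each $j$, a uniformly random subset of $N_j$ of size $k_j$, and return the union of the drawn subsets. *)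

theory Defs
  imports "HOL-Probability.Probability"
begin

text \<open>
  The pool is \<open>{1..n}\<close>. The quotas are nonnegative integers, hence naturals. \<open>V\<close> may contain
  values that no pool member has.
\<close>

definition sortition_instance ::
    "nat \<Rightarrow> (nat \<Rightarrow> 'v) \<Rightarrow> 'v set \<Rightarrow> nat \<Rightarrow> ('v \<Rightarrow> nat) \<Rightarrow> ('v \<Rightarrow> nat) \<Rightarrow> bool" where
  "sortition_instance n f V k l u \<longleftrightarrow>
     finite V \<and> f \<in> {1..n} \<rightarrow> V \<and> (\<forall>x\<in>V. l x \<le> u x \<and> u x \<le> k)"

definition panels ::
    "nat \<Rightarrow> (nat \<Rightarrow> 'v) \<Rightarrow> 'v set \<Rightarrow> nat \<Rightarrow> ('v \<Rightarrow> nat) \<Rightarrow> ('v \<Rightarrow> nat) \<Rightarrow> nat set set" where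
  "panels n f V k l u =
     {P. P \<subseteq> {1..n} \<and> card P = k \<and>
         (\<forall>x\<in>V. l x \<le> card {i \<in> P. f i = x} \<and> card {i \<in> P. f i = x} \<le> u x)}"

text \<open>
  \<^const>\<open>pmf_of_set\<close> is meaningful only for finite nonempty sets. \<^const>\<open>panels\<close> is always finite,
  and it is nonempty exactly for feasible instances.
\<close>

definition max_entropy ::
    "nat \<Rightarrow> (nat \<Rightarrow> 'v) \<Rightarrow> 'v set \<Rightarrow> nat \<Rightarrow> ('v \<Rightarrow> nat) \<Rightarrow> ('v \<Rightarrow> nat) \<Rightarrow> nat set pmf" where
  "max_entropy n f V k l u = pmf_of_set (panels n f V k l u)"

definition stratum :: "nat \<Rightarrow> (nat \<Rightarrow> 'v) \<Rightarrow> 'v \<Rightarrow> nat set" where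
  "stratum n f x = {i \<in> {1..n}. f i = x}"

text \<open>
  \<^const>\<open>Pi_pmf\<close> is the distribution of a family of independent draws indexed by \<open>{1..m}\<close>; its
  second argument is only the dummy value of the family outside the index set. The set of
  \<open>q j\<close>-subsets of the \<open>j\<close>-th stratum is nonempty iff the stratum has at least \<open>q j\<close> members,
  which feasibility guarantees.
\<close>

definition stratified_sampling ::
    "nat \<Rightarrow> (nat \<Rightarrow> 'v) \<Rightarrow> nat \<Rightarrow> (nat \<Rightarrow> 'v) \<Rightarrow> (nat \<Rightarrow> nat) \<Rightarrow> nat set pmf" where
  "stratified_sampling n f m v q =
     map_pmf (\<lambda>S. \<Union>j\<in>{1..m}. S j)
       (Pi_pmf {1..m} {}
          (\<lambda>j. pmf_of_set {S. S \<subseteq> stratum n f (v j) \<and> card S = q j}))"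

end

(* An independent family of uniform draws is a uniform draw from the product. As the strata are
   disjoint, taking unions maps the product injectively, hence bijectively onto the set of
   panels: by feasibility the tight quotas sum to the panel size, so the size constraint is
   implied by the quotas. *)
theory Submission
  imports Defs
begin

text \<open>Every \<open>S j\<close> stays inside its own block \<open>N j\<close>, so among the
  pieces of the union only \<open>S i\<close> meets \<open>N i\<close>. Intersecting with the blocks
  thus inverts the union map.\<close>

lemma Union_PiE_dflt_Int:
  assumes "disjoint_family_on N I" and "\<And>i. i \<in> I \<Longrightarrow> A i \<subseteq> Pow (N i)"
    and "S \<in> PiE_dflt I {} A" and "i \<in> I"
  shows "(\<Union>j\<in>I. S j) \<inter> N i = S i"
proof -
  have sub: "S j \<subseteq> N j" if "j \<in> I" for j
    using assms(2,3) that by (auto simp: PiE_dflt_def)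
  have "S j \<inter> N i = {}" if "j \<in> I" "j \<noteq> i" for j
    using sub[OF that(1)] assms(1,4) that unfolding disjoint_family_on_def by blast
  then show ?thesis
    using sub[OF assms(4)] assms(4) by blast
qed

lemma inj_on_Union_PiE_dflt:
  assumes "disjoint_family_on N I" and "\<And>i. i \<in> I \<Longrightarrow> A i \<subseteq> Pow (N i)"
  shows "inj_on (\<lambda>S. \<Union>i\<in>I. S i) (PiE_dflt I {} A)"
proof (rule inj_onI, rule ext)
  fix S T i
  assume S: "S \<in> PiE_dflt I {} A" and T: "T \<in> PiE_dflt I {} A"
    and eq: "(\<Union>i\<in>I. S i) = (\<Union>i\<in>I. T i)"
  show "S i = T i"
  proof (cases "i \<in> I")
    case True
    then show ?thesis
      using Union_PiE_dflt_Int[OF assms S True] Union_PiE_dflt_Int[OF assms T True] eq by simp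
  next
    case False
    \<comment> \<open>Off \<open>I\<close> both families take the default value
      \<open>{}\<close>.\<close>
    then show ?thesis using S T by (auto simp: PiE_dflt_def)
  qed
qed

text \<open>Choosing a subset of each block separately amounts to choosing one subset of the whole:
  its slices \<open>P \<inter> N i\<close> are the individual choices.\<close>

lemma image_Union_PiE_dflt_card:
  assumes "disjoint_family_on N I"
  shows "(\<lambda>S. \<Union>i\<in>I. S i) ` PiE_dflt I {} (\<lambda>i. {S. S \<subseteq> N i \<and> card S = q i}) =
    {P. P \<subseteq> (\<Union>i\<in>I. N i) \<and> (\<forall>i\<in>I. card (P \<inter> N i) = q i)}" (is "_ ` ?F = ?R")
proof (intro equalityI subsetI)
  fix P assume "P \<in> (\<lambda>S. \<Union>i\<in>I. S i) ` ?F"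
  then obtain S where S: "S \<in> ?F" and P: "P = (\<Union>i\<in>I. S i)" by blast
  have "P \<inter> N i = S i" if "i \<in> I" for i
    unfolding P by (rule Union_PiE_dflt_Int[OF assms _ S that]) auto
  then show "P \<in> ?R"
    using S P by (auto simp: PiE_dflt_def)
next
  fix P assume P: "P \<in> ?R"
  \<comment> \<open>The preimage of \<open>P\<close> is the family of its slices, extended by
    \<open>{}\<close> because \<open>PiE_dflt\<close> fixes the value off \<open>I\<close>.\<close>
  have "(\<lambda>i. if i \<in> I then P \<inter> N i else {}) \<in> ?F"
    using P by (auto simp: PiE_dflt_def)
  moreover have "P = (\<Union>i\<in>I. if i \<in> I then P \<inter> N i else {})"
    using P by auto
  ultimately show "P \<in> (\<lambda>S. \<Union>i\<in>I. S i) ` ?F" by blast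
qed

lemma disjoint_family_on_stratum:
  "inj_on v I \<Longrightarrow> disjoint_family_on (\<lambda>j. stratum n f (v j)) I"
  by (auto simp: disjoint_family_on_def stratum_def inj_on_def)

lemma panels_tight_quotas:
  assumes inst: "sortition_instance n f V k l u" and feasible: "panels n f V k l u \<noteq> {}"
    and bij: "bij_betw v I V" and tight: "\<And>j. j \<in> I \<Longrightarrow> l (v j) = q j \<and> u (v j) = q j"
  shows "panels n f V k l u =
    {P. P \<subseteq> (\<Union>j\<in>I. stratum n f (v j)) \<and> (\<forall>j\<in>I. card (P \<inter> stratum n f (v j)) = q j)}"
    (is "_ = ?R")
proof -
  have V: "v ` I = V" and inj: "inj_on v I" and fin: "finite I"
    using bij inst by (auto simp: bij_betw_def sortition_instance_def bij_betw_finite)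
  have pool: "(\<Union>j\<in>I. stratum n f (v j)) = {1..n}"
  proof -
    have "f i \<in> v ` I" if "i \<in> {1..n}" for i
      using inst that unfolding V sortition_instance_def by blast
    then show ?thesis by (auto simp: stratum_def image_iff)
  qed
  have slice: "{i \<in> P. f i = v j} = P \<inter> stratum n f (v j)" if "P \<subseteq> {1..n}" for P j
    using that by (auto simp: stratum_def)
  have quotas: "P \<in> panels n f V k l u \<longleftrightarrow> P \<in> ?R \<and> card P = k" for P
  proof -
    have "(\<forall>x\<in>V. l x \<le> card {i \<in> P. f i = x} \<and> card {i \<in> P. f i = x} \<le> u x) \<longleftrightarrow>
        (\<forall>j\<in>I. card (P \<inter> stratum n f (v j)) = q j)" if "P \<subseteq> {1..n}"
    proof -
      have "l (v j) \<le> c \<and> c \<le> u (v j) \<longleftrightarrow> c = q j" if "j \<in> I" for c j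
        using tight[OF that] by auto
      then show ?thesis
        unfolding V[symmetric] by (simp add: slice[OF that])
    qed
    then show ?thesis
      unfolding pool panels_def mem_Collect_eq by meson
  qed
  \<comment> \<open>The slices are disjoint and cover \<open>P\<close>, so all members of
    \<open>?R\<close> have the same cardinality.\<close>
  have card: "card P = (\<Sum>j\<in>I. q j)" if "P \<in> ?R" for P
  proof -
    have sub: "P \<subseteq> (\<Union>j\<in>I. stratum n f (v j))" using that by blast
    then have "card P = card (\<Union>j\<in>I. P \<inter> stratum n f (v j))"
      by (intro arg_cong[of _ _ card]) blast
    also have "\<dots> = (\<Sum>j\<in>I. card (P \<inter> stratum n f (v j)))"
      using disjoint_family_on_stratum[OF inj, of n f]
      by (intro card_UN_disjoint fin) (auto simp: stratum_def disjoint_family_on_def)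
    finally show ?thesis using that by simp
  qed
  \<comment> \<open>Feasibility enters here: a single panel, of size \<open>k\<close> and lying in
    \<open>?R\<close>, identifies \<open>k\<close> with the sum of the quotas.\<close>
  obtain P where "P \<in> panels n f V k l u"
    using feasible by (meson all_not_in_conv)
  then have "P \<in> ?R" "card P = k"
    by (simp_all only: quotas)
  then have k: "k = (\<Sum>j\<in>I. q j)"
    using card[of P] by (simp only:)
  have "P \<in> panels n f V k l u \<longleftrightarrow> P \<in> ?R" for P
    using quotas[of P] card[of P] k by argo
  then show ?thesis by (rule set_eqI)
qed

theorem proposition5p1:
  fixes n m k :: nat and f :: "nat \<Rightarrow> 'v" and V :: "'v set" and v :: "nat \<Rightarrow> 'v"
    and l u :: "'v \<Rightarrow> nat" and q :: "nat \<Rightarrow> nat"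
  assumes "sortition_instance n f V k l u"
    and "panels n f V k l u \<noteq> {}"
    and "bij_betw v {1..m} V"
    and "\<And>j. j \<in> {1..m} \<Longrightarrow> l (v j) = q j \<and> u (v j) = q j"
  shows "max_entropy n f V k l u = stratified_sampling n f m v q"
proof -
  define A where "A j = {S. S \<subseteq> stratum n f (v j) \<and> card S = q j}" for j
  have disj: "disjoint_family_on (\<lambda>j. stratum n f (v j)) {1..m}"
    using assms(3) by (auto simp: bij_betw_def intro: disjoint_family_on_stratum)
  have img: "(\<lambda>S. \<Union>j\<in>{1..m}. S j) ` PiE_dflt {1..m} {} A = panels n f V k l u"
    unfolding A_def image_Union_PiE_dflt_card[OF disj]
    by (rule panels_tight_quotas[OF assms, symmetric])
  have inj: "inj_on (\<lambda>S. \<Union>j\<in>{1..m}. S j) (PiE_dflt {1..m} {} A)"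
    using disj by (rule inj_on_Union_PiE_dflt) (auto simp: A_def)
  have finA: "finite (A j)" for j
    by (rule finite_subset[of _ "Pow {1..n}"]) (auto simp: A_def stratum_def)
  \<comment> \<open>Feasibility passes through \<open>img\<close> to the product, and a nonempty
    product has no empty factor, so every \<open>pmf_of_set (A j)\<close> is a genuine uniform
    distribution.\<close>
  have ne: "PiE_dflt {1..m} {} A \<noteq> {}" using assms(2)[folded img] by blast
  then obtain S where "S \<in> PiE_dflt {1..m} {} A" by blast
  then have neA: "A j \<noteq> {}" if "j \<in> {1..m}" for j
    using that unfolding PiE_dflt_def by blast
  have fin: "finite (PiE_dflt {1..m} {} A)" using finA by (intro finite_PiE_dflt) auto
  have "Pi_pmf {1..m} {} (\<lambda>j. pmf_of_set (A j)) = pmf_of_set (PiE_dflt {1..m} {} A)"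
    using finA neA by (intro Pi_pmf_of_set) auto
  then show ?thesis
    \<comment> \<open>An injective map carries the uniform distribution on a finite nonempty set to
      the uniform one on its image.\<close>
    using map_pmf_of_set_inj[OF inj ne fin]
    unfolding max_entropy_def stratified_sampling_def A_def[symmetric] img by simp
qed

end
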